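(* Let $x,y$ be roots of unity with $x\ne1$, let $a\in\mathbb{C}\setminus\mathbb{Z}$, and let $p,q\ge1$ be integers with $(p,y)\ne(1,1)$ and $(q,xy)\neq(1,1)$. Then \begin{align*} &y^{-1}\tilde{S}^{(a-1)}_{p;q}\big(y;(xy)^{-1}\big)-(-1)^{p+q}\tilde{S}^{(-a)}_{p;q}\big(y^{-1};xy\big)\\ &=y^{-1}\mathrm{Li}_q\big((xy)^{-1}\big)\mathrm{Li}_p(y;a)+(-1)^q y^{-1}\mathrm{Li}_{q}(xy)\mathrm{Li}_p(y;a)+(-1)^q\binom{p+q-1}{p-1}y^{-1}\mathrm{Li}_{p+q}(y;a)\\ &\quad+(-1)^q (xy)^{-1}\sum_{m=0}^{p-1}\binom{p+q-m-2}{q-1}\mathrm{Li}_{p+q-m-1}(xy;a)\left((-1)^m\mathrm{Li}_{m+1}(x;1-a)-x\,\mathrm{Li}_{m+1}\big(x^{-1};a\big)\right)\\ &\quad+(-1)^q y^{-1}\sum_{m=0}^{q-1}\binom{p+q-m-2}{p-1}\mathrm{Li}_{p+q-m-1}(y;a)\left((-1)^m\mathrm{Li}_{m+1}\big(x^{-1}\big)-\mathrm{Li}_{m+1}(x)\right). \end{align*}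
   Context: For $|w|\le1$, $m\in\mathbb{N}$ with $(m,w)\ne(1,1)$, $b\in\mathbb{C}\setminus\{0,-1,-2,\dots\}$: $\mathrm{Li}_m(w;b)=\sum_{n\ge1}\frac{w^n}{(n+b-1)^m}$, $\mathrm{Li}_m(w)=\sum_{n\ge1}\frac{w^n}{n^m}$. For $n\ge0$: $\zeta_n(p;w;b)=\sum_{k=1}^n\frac{w^k}{(k+b)^p}$. For roots of unity $u,v$, $p,q\in\mathbb{N}$ with $(q,v)\ne(1,1)$, $b\in\mathbb{C}\setminus\mathbb{Z}$: $\tilde S^{(b)}_{p;q}(u;v)=\sum_{n\ge1}\frac{\zeta_n(p;u;b)}{n^q}v^n$. *)

theory Defs
  imports "HOL-Analysis.Analysis"
begin

text \<open>
  All series are summed with \<^const>\<open>suminf\<close>, i.e. as limits of partial sums in the natural order: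
  for exponent 1 they converge only conditionally. \<^const>\<open>suminf\<close> starts at 0, so the summation
  index is written \<^term>\<open>Suc n\<close>.
\<close>

definition root_of_unity :: "complex \<Rightarrow> bool" where
  "root_of_unity z \<longleftrightarrow> (\<exists>n::nat. n > 0 \<and> z ^ n = 1)"

definition Li_shift :: "nat \<Rightarrow> complex \<Rightarrow> complex \<Rightarrow> complex" where
  "Li_shift m w b = (\<Sum>n. w ^ Suc n / (of_nat (Suc n) + b - 1) ^ m)"

definition Li :: "nat \<Rightarrow> complex \<Rightarrow> complex" where
  "Li m w = (\<Sum>n. w ^ Suc n / of_nat (Suc n) ^ m)"

definition zeta_partial :: "nat \<Rightarrow> nat \<Rightarrow> complex \<Rightarrow> complex \<Rightarrow> complex" where
  "zeta_partial n p w b = (\<Sum>k=1..n. w ^ k / (of_nat k + b) ^ p)"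

text \<open>\<open>S_tilde b p q u v\<close> is $\tilde S^{(b)}_{p;q}(u;v)$.\<close>

definition S_tilde :: "complex \<Rightarrow> nat \<Rightarrow> nat \<Rightarrow> complex \<Rightarrow> complex \<Rightarrow> complex" where
  "S_tilde b p q u v = (\<Sum>n. zeta_partial (Suc n) p u b / of_nat (Suc n) ^ q * v ^ Suc n)"

end

theory Submission
  imports Defs
begin

text \<open>
  With $z = xy$ and $F(n) = \sum_{0 \le k < n} y^k/(k+a)^p$ (for $n < 0$: minus the sum over
  $n \le k < 0$), the left-hand side is the bilateral sum $\sum_{n \ne 0} z^{-n} n^{-q} F(n)$.
  Write $F(n) = A - \sum_{j \ge 0} y^{n+j}/(n+j+a)^p$; the constant $A = y^{-1}\mathrm{Li}_p(y;a)$
  yields the first two terms on the right. In the remaining double sum, truncated to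
  $0 < |n| \le N$, exchange the summations and decompose $n^{-q}(n+s)^{-p}$ with $s = j+a$ into
  partial fractions. The parts in $1/n$ factor. The parts in $1/(n+s)$ give the sums of
  $x^{-k}/(k+a)^i$ over the window $|k-j| \le N$, weighted by $z^j/(j+a)^r$; adding the excluded
  $n = 0$ produces the binomial term, by the hockey-stick identity. As $N \to \infty$, the window
  sum is the full bilateral sum for $j < N$ and $0$ for $j \ge N$, up to an error
  $O(1/(1+|j-N|))$. Since $\sum_j \frac{1}{(j+1)(1+|j-N|)} \to 0$, the limit can be taken even
  where the series converge only conditionally.
\<close>

subsection \<open>Tails of polylogarithm series\<close>

text \<open>Telescoping comparison: since k + 2 \<le> 2(k + 1), the bound C/(k+1)^2 is at most
  2C/((k+1)(k+2)), which is the decrement of 2C/(k+1). This keeps the tail explicit.\<close>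

lemma sum_inverse_squares_tail:
  fixes e :: "nat \<Rightarrow> complex"
  assumes "\<And>k. norm (e k) \<le> C / real (Suc k) ^ 2"
  shows "summable e" "norm (\<Sum>k. e (k + n)) \<le> 2 * C / real (Suc n)"
proof -
  have C: "C \<ge> 0" using order_trans[OF norm_ge_zero assms[of 0]] by simp
  define t where "t k = 2 * C / real (Suc k)" for k
  have "t \<longlonglongrightarrow> 0" unfolding t_def
    by (rule LIMSEQ_Suc[OF lim_const_over_n])
  then have t: "(\<lambda>k. t (k + n)) \<longlonglongrightarrow> 0" for n by (rule LIMSEQ_ignore_initial_segment)
  have ts: "(\<lambda>k. t (k + n) - t (Suc k + n)) sums t n" for n
    using telescope_sums'[OF t[of n]] by simp
  have le: "norm (e k) \<le> t k - t (Suc k)" for k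
  proof -
    have "C / real (Suc k) ^ 2 \<le> t k - t (Suc k)"
    proof -
      have "t k - t (Suc k) = 2 * C / (real (Suc k) * real (Suc (Suc k)))"
        by (simp add: t_def divide_simps) (simp add: algebra_simps)
      also have "\<dots> \<ge> 2 * C / (real (Suc k) * (2 * real (Suc k)))"
        by (rule divide_left_mono) (use C in auto)
      also have "2 * C / (real (Suc k) * (2 * real (Suc k))) = C / real (Suc k) ^ 2"
        by (simp only: power2_eq_square) (simp add: divide_simps)
      finally show ?thesis .
    qed
    with assms[of k] show ?thesis by linarith
  qed
  show "summable e"
    by (rule summable_comparison_test[OF _ sums_summable[OF ts[of 0]]]) (use le in auto)
  show "norm (\<Sum>k. e (k + n)) \<le> 2 * C / real (Suc n)"
    using norm_suminf_le[OF _ sums_summable[OF ts[of n]], of "\<lambda>k. e (k + n)"] le[of "_ + n"]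
      sums_unique[OF ts[of n]] by (simp add: t_def)
qed

text \<open>Summation by parts in abstract form: in the tail from \<open>n\<close> on, the
  differences of \<open>h\<close> collapse to \<open>h n\<close>, and \<open>e\<close> converges
  absolutely. Both are O(1/n), even where \<open>f\<close> itself is only conditionally
  summable.\<close>

lemma abel_summation_tail:
  fixes h e :: "nat \<Rightarrow> complex"
  assumes "\<And>k. f k = h k - h (Suc k) + e k"
    and "\<And>k. norm (h k) \<le> C / real (Suc k)"
    and "\<And>k. norm (e k) \<le> D / real (Suc k) ^ 2"
  shows "summable f" "norm (suminf f - (\<Sum>k<n. f k)) \<le> (C + 2 * D) / real (Suc n)"
proof -
  have "(\<lambda>k. C / real (Suc k)) \<longlonglongrightarrow> 0"
    by (rule LIMSEQ_Suc[OF lim_const_over_n])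
  then have h: "h \<longlonglongrightarrow> 0" by (rule Lim_null_comparison[rotated]) (use assms(2) in auto)
  have e: "summable e" by (rule sum_inverse_squares_tail[OF assms(3)])
  have f: "(\<lambda>k. f (k + n)) sums (h n + (\<Sum>k. e (k + n)))" for n
    using sums_add[OF telescope_sums'[OF LIMSEQ_ignore_initial_segment[OF h, of n]]
        summable_sums[OF summable_ignore_initial_segment[OF e, of n]]]
    by (simp add: assms(1))
  show sf: "summable f" using sums_summable[OF f[of 0]] by simp
  have "suminf f - (\<Sum>k<n. f k) = h n + (\<Sum>k. e (k + n))"
    using suminf_minus_initial_segment[OF sf, of n] sums_unique[OF f[of n]] by simp
  also have "norm \<dots> \<le> C / real (Suc n) + 2 * D / real (Suc n)"
    by (rule norm_triangle_mono[OF assms(2) sum_inverse_squares_tail(2)[OF assms(3)]])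
  finally show "norm (suminf f - (\<Sum>k<n. f k)) \<le> (C + 2 * D) / real (Suc n)"
    by (simp add: add_divide_distrib)
qed

text \<open>The quotient (k+1)/(k+b) = 1 + (1-b)/(k+b) converges to 1, hence is bounded, so one
  \<open>K\<close> serves all \<open>k\<close>.\<close>

lemma inverse_shift_bound:
  fixes b :: complex
  assumes "\<And>k::nat. of_nat k + b \<noteq> 0"
  obtains K where "K > 0" "\<And>k. norm (1 / (of_nat k + b)) \<le> K / real (Suc k)"
proof -
  have "(\<lambda>k. inverse (of_nat k + b)) \<longlonglongrightarrow> 0"
    by (rule filterlim_compose[OF tendsto_inverse_0])
      (rule tendsto_add_filterlim_at_infinity'[OF tendsto_of_nat tendsto_const])
  then have "(\<lambda>k. 1 + (1 - b) * inverse (of_nat k + b)) \<longlonglongrightarrow> 1 + (1 - b) * 0"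
    by (intro tendsto_add tendsto_mult tendsto_const)
  moreover have "1 + (1 - b) * inverse (of_nat k + b) = of_nat (Suc k) / (of_nat k + b)" for k
  proof -
    have "1 + (1 - b) * inverse c = (c + (1 - b)) / c" if "c \<noteq> 0" for c
      using that by (simp add: divide_inverse distrib_right)
    from this[OF assms[of k]] show ?thesis by simp
  qed
  ultimately have "convergent (\<lambda>k. of_nat (Suc k) / (of_nat k + b))"
    by (auto simp: convergent_def)
  then have "Bseq (\<lambda>k. of_nat (Suc k) / (of_nat k + b))" by (rule convergent_imp_Bseq)
  then obtain K where "K > 0" "\<And>k. norm (of_nat (Suc k) / (of_nat k + b)) \<le> K"
    unfolding Bseq_def by blast
  moreover have "norm (1 / (of_nat k + b)) = norm (of_nat (Suc k) / (of_nat k + b)) / real (Suc k)" for k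
    by (simp only: norm_divide norm_of_nat norm_one) simp
  ultimately have "norm (1 / (of_nat k + b)) \<le> K / real (Suc k)" for k
    using divide_right_mono[of _ K "real (Suc k)"] by (simp only: of_nat_0_le_iff)
  with \<open>K > 0\<close> show ?thesis by (rule that)
qed

text \<open>For \<open>p \<ge> 2\<close> the terms are O(1/k^2) and no boundary term is needed; for
  \<open>p = 1\<close> the hypothesis forces \<open>w \<noteq> 1\<close> and summation by parts
  applies. The rate 1/n, not just convergence, is what the window estimates rest on.\<close>

lemma polylog_tail:
  fixes b w :: complex
  assumes b: "\<And>k::nat. of_nat k + b \<noteq> 0" and w: "norm w = 1" and p: "p \<ge> 1" "(p, w) \<noteq> (1, 1)"
  defines "f \<equiv> \<lambda>k::nat. w ^ k / (of_nat k + b) ^ p"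
  shows "summable f" "\<exists>C. \<forall>n. norm (suminf f - (\<Sum>k<n. f k)) \<le> C / real (Suc n)"
proof -
  obtain K where K: "K > 0" "\<And>k. norm (1 / (of_nat k + b)) \<le> K / real (Suc k)"
    using inverse_shift_bound[OF b] by blast
  obtain h e C D where "\<And>k. f k = h k - h (Suc k) + e k"
    "\<And>k. norm (h k) \<le> C / real (Suc k)" "\<And>k. norm (e k) \<le> D / real (Suc k) ^ 2"
  proof (cases "p \<ge> 2")
    case True
    have "norm (f k) \<le> K ^ p / real (Suc k) ^ 2" for k
    proof -
      have "norm (f k) = norm (1 / (of_nat k + b)) ^ p"
        by (simp add: f_def norm_divide norm_power w power_divide)
      also have "\<dots> \<le> (K / real (Suc k)) ^ p" by (intro power_mono K) auto
      also have "\<dots> \<le> K ^ p / real (Suc k) ^ 2"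
        unfolding power_divide
        by (intro divide_left_mono power_increasing True mult_pos_pos zero_less_power) (use K in auto)
      finally show ?thesis .
    qed
    then show ?thesis by (intro that[of "\<lambda>_. 0" f 0 "K ^ p"]) simp_all
  next
    case False
    with p have p1: "p = 1" "w \<noteq> 1" by auto
    \<comment> \<open>As w^k = (w^k - w^(k+1))/(1 - w), \<open>h\<close> is the geometric
      antiderivative times 1/(k+b), and \<open>e\<close> corrects for the change of 1/(k+b) from
      \<open>k\<close> to \<open>Suc k\<close>. That change is minus the product of the two
      consecutive reciprocals, hence of second order.\<close>
    define h where "h k = w ^ k / (of_nat k + b) / (1 - w)" for k
    define e where "e k = w ^ Suc k * (1 / (of_nat (Suc k) + b) * - (1 / (of_nat k + b))) / (1 - w)" for k
    show ?thesis
    proof (rule that[of h e])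
      fix k
      define A B where "A = 1 / (of_nat k + b)" and "B = 1 / (of_nat (Suc k) + b)"
      have "A * B = A - B"
        using b[of k] b[of "Suc k"] by (simp add: A_def B_def divide_simps)
      then have "e k = w ^ Suc k * (B - A) / (1 - w)"
        unfolding e_def A_def[symmetric] B_def[symmetric] by (simp only: mult_minus_right mult.commute[of B A] minus_diff_eq)
      then have "h k - h (Suc k) + e k = (w ^ k * A - w ^ Suc k * B + w ^ Suc k * (B - A)) / (1 - w)"
        by (simp add: h_def A_def B_def diff_divide_distrib add_divide_distrib)
      also have "\<dots> = w ^ k * A * (1 - w) / (1 - w)" by (simp add: algebra_simps)
      finally show "f k = h k - h (Suc k) + e k"
        using p1 by (simp add: f_def A_def)
      show "norm (h k) \<le> K / norm (1 - w) / real (Suc k)"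
        using divide_right_mono[OF K(2)[of k], of "norm (1 - w)"]
        by (simp add: h_def norm_divide norm_mult norm_power w mult_ac)
      have "norm (e k) = norm (1 / (of_nat (Suc k) + b)) * norm (1 / (of_nat k + b)) / norm (1 - w)"
        by (simp add: e_def norm_divide norm_mult norm_power w)
      also have "\<dots> \<le> (K / real (Suc k)) * (K / real (Suc k)) / norm (1 - w)"
      proof (intro divide_right_mono mult_mono K)
        show "norm (1 / (of_nat (Suc k) + b)) \<le> K / real (Suc k)"
          by (rule order_trans[OF K(2)]) (use K in \<open>simp add: frac_le\<close>)
      qed (use K in auto)
      finally show "norm (e k) \<le> K ^ 2 / norm (1 - w) / real (Suc k) ^ 2"
        by (simp add: power2_eq_square mult_ac)
    qed
  qed
  note * = abel_summation_tail[OF this]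
  show "summable f" by (rule *)
  show "\<exists>C. \<forall>n. norm (suminf f - (\<Sum>k<n. f k)) \<le> C / real (Suc n)" using *(2) by blast
qed


subsection \<open>Partial fractions\<close>

text \<open>Meant for u = 1/n, v = 1/(n+s), t = 1/s, where the hypothesis is the elementary
  decomposition of 1/(n(n+s)). Using only this relation avoids all division. Each application lowers
  one of the two exponents, so induction on \<open>P + Q\<close> works.\<close>

lemma partial_fractions_Suc:
  fixes u v t :: "'a :: comm_ring_1"
  assumes "u * v = t * (u - v)"
  shows "u ^ Suc Q * v ^ Suc P =
    (\<Sum>k\<le>Q. of_nat ((P + k) choose k) * (-t) ^ k * t ^ Suc P * u ^ (Suc Q - k)) +
    (\<Sum>k\<le>P. of_nat ((Q + k) choose k) * t ^ k * (-t) ^ Suc Q * v ^ (Suc P - k))"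
proof -
  \<comment> \<open>One function covers both sums: exchanging \<open>u\<close> with \<open>v\<close>
    and \<open>t\<close> with \<open>-t\<close> preserves the hypothesis and swaps them.\<close>
  define S :: "nat \<Rightarrow> nat \<Rightarrow> 'a \<Rightarrow> 'a \<Rightarrow> 'a"
    where "S P Q t u = (\<Sum>k\<le>Q. of_nat ((P + k) choose k) * (-t) ^ k * t ^ Suc P * u ^ (Suc Q - k))"
    for P Q t u
  have S0: "S P 0 t u = t ^ Suc P * u" for P t u by (simp add: S_def)
  have S1: "S 0 (Suc Q) t u = t * (u ^ Suc (Suc Q)) - t * S 0 Q t u" for Q t u
    by (simp add: S_def sum.atMost_Suc_shift sum_distrib_left sum_negf mult_ac del: sum.atMost_Suc)
  \<comment> \<open>Pascal's rule for the coefficients, matching the recursion \<open>step\<close>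
    below; in \<open>S1\<close> all the binomials are 1.\<close>
  have S2: "S (Suc P) (Suc Q) t u = t * S P (Suc Q) t u - t * S (Suc P) Q t u" for P Q t u
    by (simp add: S_def sum.atMost_Suc_shift sum_distrib_left sum.distrib sum_negf sum_subtractf algebra_simps
        del: sum.atMost_Suc)
  have "u ^ Suc Q * v ^ Suc P = S P Q t u + S Q P (-t) v"
  proof (induction "P + Q" arbitrary: P Q rule: less_induct)
    case less
    have step: "u ^ Suc Q * v ^ Suc P = t * (u ^ Suc Q * v ^ P - u ^ Q * v ^ Suc P)" for P Q
      using arg_cong[OF assms, of "\<lambda>z. u ^ Q * v ^ P * z"] by (simp add: algebra_simps)
    show ?case
    proof (cases P)
      case P: 0
      show ?thesis
      proof (cases Q)
        case 0
        then show ?thesis using assms P by (simp add: S0 algebra_simps)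
      next
        case Q: (Suc Q')
        have "u ^ Suc Q' * v = S 0 Q' t u + S Q' 0 (-t) v"
          using less[of 0 Q'] P Q by simp
        moreover have "u ^ Suc Q * v ^ Suc P = t * u ^ Suc Q - t * (u ^ Suc Q' * v)"
          using step[of Q 0] by (simp add: P Q right_diff_distrib)
        ultimately show ?thesis
          by (simp only: P Q S0 S1) (simp add: right_diff_distrib distrib_left mult_ac)
      qed
    next
      case P: (Suc P')
      show ?thesis
      proof (cases Q)
        case Q: 0
        have "u * v ^ Suc P' = S P' 0 t u + S 0 P' (-t) v"
          using less[of P' 0] P Q by simp
        moreover have "u ^ Suc Q * v ^ Suc P = t * (u * v ^ Suc P') - t * v ^ Suc P"
          using step[of 0 P] by (simp add: P Q right_diff_distrib)
        ultimately show ?thesis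
          by (simp only: P Q S0 S1) (simp add: right_diff_distrib distrib_left mult_ac)
      next
        case Q: (Suc Q')
        have "u ^ Suc Q * v ^ Suc P = t * (u ^ Suc Q * v ^ Suc P') - t * (u ^ Suc Q' * v ^ Suc P)"
          using step[of Q P] by (simp only: P Q right_diff_distrib)
        moreover have "u ^ Suc Q * v ^ Suc P' = S P' Q t u + S Q P' (-t) v"
          "u ^ Suc Q' * v ^ Suc P = S P Q' t u + S Q' P (-t) v"
          using less[of P' Q] less[of P Q'] P Q by auto
        ultimately show ?thesis
          by (simp only: P Q S2) (simp add: right_diff_distrib distrib_left)
      qed
    qed
  qed
  then show ?thesis by (simp add: S_def)
qed

subsection \<open>Indefinite sums over the integers\<close>

text \<open>The discrete antiderivative of \<open>f\<close> that vanishes at 0, called F in the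
  overview. The sign on the negative side makes the difference equation \<open>prim_plus_one\<close>
  hold at every integer.\<close>

definition prim :: "(int \<Rightarrow> 'a :: ab_group_add) \<Rightarrow> int \<Rightarrow> 'a" where
  "prim f m = (if m \<ge> 0 then \<Sum>k<nat m. f (int k) else - (\<Sum>k<nat (- m). f (- 1 - int k)))"

lemma prim_of_nat: "prim f (int n) = (\<Sum>k<n. f (int k))"
  by (simp add: prim_def)

lemma prim_minus_of_nat: "prim f (- int n) = - (\<Sum>k<n. f (- 1 - int k))"
  by (cases "n = 0") (simp_all add: prim_def)

lemma prim_plus_one: "prim f (m + 1) = prim f m + f m"
proof (cases m)
  case (nonneg n)
  then show ?thesis using prim_of_nat[of f n] prim_of_nat[of f "Suc n"] by (simp add: add.commute)
next
  case (neg n)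
  then show ?thesis using prim_minus_of_nat[of f n] prim_minus_of_nat[of f "Suc n"] by simp
qed

lemma sum_eq_prim_diff: "sum f {l..l + int n} = prim f (l + int n + 1) - prim f l"
proof (induction n)
  case 0
  then show ?case by (simp add: prim_plus_one)
next
  case (Suc n)
  have "{l..l + int (Suc n)} = insert (l + int n + 1) {l..l + int n}" by auto
  then show ?case using Suc prim_plus_one[of f "l + int n + 1"] by (simp add: add_ac)
qed

text \<open>Moving \<open>n\<close> by one adds or removes a single term on both sides, so induction
  in both directions from 0 reaches every integer.\<close>

lemma sums_prim:
  fixes f :: "int \<Rightarrow> 'a :: real_normed_vector"
  assumes "(\<lambda>j. f (int j)) sums A"
  shows "(\<lambda>j. f (n + int j)) sums (A - prim f n)"
proof (induction n rule: int_induct[where k = 0])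
  case base
  then show ?case using assms by (simp add: prim_def)
next
  case (step1 i)
  have "A - prim f (i + 1) = A - prim f i - f i" by (simp add: prim_plus_one)
  moreover have "i + 1 + int j = i + int (j + 1)" for j by simp
  ultimately show ?case
    using sums_split_initial_segment[OF step1(2), of 1] by (simp only:) simp
next
  case (step2 i)
  have "i - 1 + int (Suc j) = i + int j" for j by simp
  moreover have "A - prim f i = A - prim f (i - 1) - f (i - 1 + int 0)"
    using prim_plus_one[of f "i - 1"] by simp
  ultimately have "(\<lambda>j. f (i - 1 + int (Suc j))) sums (A - prim f (i - 1) - f (i - 1 + int 0))"
    using step2(2) by (simp only:)
  then show ?case
    by (subst (asm) sums_Suc_iff) (simp only: diff_add_cancel)
qed

text \<open>\<open>L\<close> and \<open>M\<close> are the limits of the antiderivative at plus and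
  minus infinity, so \<open>L - M\<close> is the full bilateral sum of \<open>f\<close>. Both rates
  come from \<open>polylog_tail\<close>, the negative side after the reflection k to -1-k.\<close>

lemma prim_polylog:
  fixes a w :: complex
  assumes a: "a \<notin> \<int>" and w: "norm w = 1" and p: "p \<ge> 1" "(p, w) \<noteq> (1, 1)"
  defines "f \<equiv> \<lambda>k::int. w powi k / (of_int k + a) ^ p"
  defines "L \<equiv> inverse w * Li_shift p w a"
  defines "M \<equiv> - ((- 1) ^ p) * Li_shift p (inverse w) (1 - a)"
  shows "(\<lambda>j. f (int j)) sums L"
    and "\<exists>C. \<forall>m. norm (prim f m - (if m \<ge> 0 then L else M)) \<le> C / (1 + \<bar>real_of_int m\<bar>)"
proof -
  have w0: "w \<noteq> 0" using w by auto
  have nz: "of_int k + a \<noteq> 0" for k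
    using a by (metis Ints_minus Ints_of_int add.commute eq_neg_iff_add_eq_0)
  define g where "g = (\<lambda>k::nat. w ^ k / (of_nat k + a) ^ p)"
  define h where "h = (\<lambda>k::nat. inverse w ^ k / (of_nat k + (1 - a)) ^ p)"
  have nza: "of_nat k + a \<noteq> 0" for k using nz[of "int k"] by simp
  have nzb: "of_nat k + (1 - a) \<noteq> 0" for k
    using nz[of "- 1 - int k"] by (auto simp: algebra_simps)
  have w': "norm (inverse w) = 1" "(p, inverse w) \<noteq> (1, 1)" using w p by (auto simp: norm_inverse)
  note g = polylog_tail[OF nza w p, folded g_def]
  note h = polylog_tail[OF nzb w'(1) p(1) w'(2), folded h_def]
  have fg: "f (int k) = g k" for k by (simp add: f_def g_def)
  \<comment> \<open>Reflection sends \<open>k + a\<close> to -(k + (1 - a)), whence the shift 1 - a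
    and the sign. The extra \<open>inverse w\<close> matches \<open>Li_shift\<close> starting at the
    first power, so \<open>M\<close> carries no such factor while \<open>L\<close> does.\<close>
  have fh: "f (- 1 - int k) = (- 1) ^ p * inverse w * h k" for k
  proof -
    have "w powi (- 1 - int k) = inverse w * inverse w ^ k"
      using w0 by (simp add: power_int_diff power_int_minus field_simps)
    moreover have "of_int (- 1 - int k) + a = - 1 * (of_nat k + (1 - a))" by simp
    moreover have "x / ((- 1) ^ p * y) = (- 1) ^ p * (x / y)" for x y :: complex
      by (cases "even p") auto
    ultimately show ?thesis
      unfolding f_def h_def by (simp only: power_mult_distrib) (simp only: times_divide_eq_right mult.assoc)
  qed
  have "Li_shift p w a = (\<Sum>n. w * g n)" by (simp add: Li_shift_def g_def)
  also have "\<dots> = w * suminf g" by (rule suminf_mult[OF g(1)])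
  finally have L: "L = suminf g" using w0 by (simp add: L_def)
  have "Li_shift p (inverse w) (1 - a) = (\<Sum>n. inverse w * h n)"
    by (simp add: Li_shift_def h_def algebra_simps)
  also have "\<dots> = inverse w * suminf h" by (rule suminf_mult[OF h(1)])
  finally have M: "M = - ((- 1) ^ p * inverse w) * suminf h" by (simp add: M_def)
  show "(\<lambda>j. f (int j)) sums L"
    using summable_sums[OF g(1)] by (simp add: fg L)
  obtain C where C: "\<And>n. norm (suminf g - (\<Sum>k<n. g k)) \<le> C / real (Suc n)" using g(2) by blast
  obtain D where D: "\<And>n. norm (suminf h - (\<Sum>k<n. h k)) \<le> D / real (Suc n)" using h(2) by blast
  have "norm (prim f m - (if m \<ge> 0 then L else M)) \<le> max C D / (1 + \<bar>real_of_int m\<bar>)" for m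
  proof (cases m)
    case (nonneg n)
    then have "norm (prim f m - (if m \<ge> 0 then L else M)) = norm (suminf g - (\<Sum>k<n. g k))"
      by (simp add: prim_of_nat fg L norm_minus_commute)
    also have "\<dots> \<le> max C D / real (Suc n)"
      by (rule order_trans[OF C]) (simp add: divide_right_mono)
    finally show ?thesis using nonneg by simp
  next
    case (neg n)
    then have "prim f m - (if m \<ge> 0 then L else M) =
        - ((- 1) ^ p * inverse w * (\<Sum>k<Suc n. h k)) - - ((- 1) ^ p * inverse w) * suminf h"
      using prim_minus_of_nat[of f "Suc n"] by (simp only: fh M sum_distrib_left) simp
    also have "\<dots> = (- 1) ^ p * inverse w * (suminf h - (\<Sum>k<Suc n. h k))"
      by (simp only: right_diff_distrib mult_minus_left minus_diff_minus minus_diff_eq)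
    also have "norm \<dots> = norm (suminf h - (\<Sum>k<Suc n. h k))"
      by (simp only: norm_mult norm_power w') simp
    also have "\<dots> \<le> max C D / real (Suc (Suc n))"
      by (rule order_trans[OF D]) (simp add: divide_right_mono)
    finally show ?thesis using neg by simp
  qed
  then show "\<exists>C. \<forall>m. norm (prim f m - (if m \<ge> 0 then L else M)) \<le> C / (1 + \<bar>real_of_int m\<bar>)"
    by blast
qed

subsection \<open>Sums against a moving window\<close>

text \<open>
  The split $1 = \frac14 + \frac34$ of the exponent leaves a factor that tends to $0$ as $M \to \infty$,
  while AM-GM turns the rest into the summable powers $-\frac32$.
\<close>

lemma inverse_mult_bound:
  fixes u v M :: real
  assumes "u \<ge> 1" "v \<ge> 1" "u + v \<ge> M" "M > 0"
  shows "1 / (u * v) \<le> (M / 2) powr (- 1 / 4) * (u powr (- 3 / 2) + v powr (- 3 / 2))"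
proof -
  define s t where "s = u powr (- 3 / 4)" and "t = v powr (- 3 / 4)"
  \<comment> \<open>The larger of the two numbers is at least M/2 and the other is at least
    1.\<close>
  have uv: "M / 2 \<le> u * v"
  proof (cases "u \<le> v")
    case True
    then show ?thesis using mult_mono[of 1 u v v] assms by linarith
  next
    case False
    then show ?thesis using mult_mono[of u u 1 v] assms by linarith
  qed
  have sq: "u powr (- 3 / 2) = s\<^sup>2" "v powr (- 3 / 2) = t\<^sup>2"
    by (simp_all add: s_def t_def power2_eq_square flip: powr_add)
  have "1 / (u * v) = (u * v) powr (- 1 / 4 + - 3 / 4)"
    using assms by (simp add: powr_minus_divide)
  also have "\<dots> = (u * v) powr (- 1 / 4) * (s * t)"
    unfolding s_def t_def by (subst powr_add) (use assms in \<open>simp add: powr_mult\<close>)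
  also have "\<dots> \<le> (M / 2) powr (- 1 / 4) * (s\<^sup>2 + t\<^sup>2)"
  proof (rule mult_mono)
    show "(u * v) powr (- 1 / 4) \<le> (M / 2) powr (- 1 / 4)"
      by (rule powr_mono2') (use uv assms in auto)
    show "s * t \<le> s\<^sup>2 + t\<^sup>2"
      using sum_squares_bound[of s t] zero_le_power2[of s] zero_le_power2[of t] by linarith
  qed (auto simp: s_def t_def)
  finally show ?thesis unfolding sq .
qed

text \<open>Replacing \<open>g N j\<close> by its step function leaves a partial sum of
  \<open>h\<close> times \<open>G\<close>, so conditional convergence of \<open>h\<close> suffices.
  The error is at most a multiple of the sum over j of 1/((j+1)(1+|j-N|)), which tends to 0.\<close>

lemma sum_concentrated_kernel:
  fixes h :: "nat \<Rightarrow> complex" and g :: "nat \<Rightarrow> nat \<Rightarrow> complex"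
  assumes h: "h sums L" "\<And>j. norm (h j) \<le> C / real (Suc j)"
    and g: "\<And>N j. norm (g N j - (if j < N then G else 0)) \<le> D / (1 + \<bar>real j - real N\<bar>)"
  shows "summable (\<lambda>j. h j * g N j)" "(\<lambda>N. \<Sum>j. h j * g N j) \<longlonglongrightarrow> L * G"
proof -
  have C: "C \<ge> 0" using order_trans[OF norm_ge_zero h(2)[of 0]] by simp
  have D: "D \<ge> 0" using order_trans[OF norm_ge_zero g[of 0 0]] by simp
  \<comment> \<open>\<open>V N\<close> is \<open>W\<close> recentred at \<open>N\<close>. The factor
    \<open>\<epsilon> N\<close> is the one from \<open>inverse_mult_bound\<close> with M = N + 2, as
    (j+1) + (1+|j-N|) \<ge> N + 2.\<close>
  define W where "W k = real (Suc k) powr (- 3 / 2)" for k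
  define V where "V N j = (if j < N then W (N - j) else W (j - N))" for N j
  define \<epsilon> where "\<epsilon> N = (real (N + 2) / 2) powr (- 1 / 4)" for N
  define e where "e N j = h j * (g N j - (if j < N then G else 0))" for N j
  have W: "summable W" "\<And>k. W k \<ge> 0"
    unfolding W_def by (subst summable_Suc_iff) (simp_all add: summable_real_powr_iff)
  have sV: "summable (V N)" for N
  proof -
    have "(\<lambda>j. V N (j + N)) = W" by (simp add: V_def)
    with W show ?thesis using summable_iff_shift[of "V N" N] by simp
  qed
  \<comment> \<open>The terms left of \<open>N\<close> are a reversed partial sum of
    \<open>W\<close> and those from \<open>N\<close> on are all of \<open>W\<close>, which gives a
    bound uniform in \<open>N\<close>.\<close>
  have V: "suminf (V N) \<le> 2 * suminf W" for N
  proof -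
    have "(\<Sum>j<N. V N j) = (\<Sum>j<N. W (Suc j))"
      unfolding sum.nat_diff_reindex[of "V N", symmetric] by (rule sum.cong) (auto simp: V_def)
    also have "\<dots> \<le> (\<Sum>j<Suc N. W j)" using W by (simp add: sum.lessThan_Suc_shift del: sum.lessThan_Suc)
    also have "\<dots> \<le> suminf W" by (rule sum_le_suminf) (use W in auto)
    finally have "(\<Sum>j<N. V N j) \<le> suminf W" .
    moreover have "suminf (V N) = (\<Sum>j. V N (j + N)) + (\<Sum>j<N. V N j)"
      by (rule suminf_split_initial_segment[OF sV])
    moreover have "(\<lambda>j. V N (j + N)) = W" by (simp add: V_def)
    ultimately show ?thesis by simp
  qed
  have e: "norm (e N j) \<le> C * D * \<epsilon> N * (W j + V N j)" for N j
  proof -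
    have "norm (e N j) \<le> C / real (Suc j) * (D / (1 + \<bar>real j - real N\<bar>))"
      unfolding e_def norm_mult by (rule mult_mono[OF h(2) g]) (use C in auto)
    also have "\<dots> = C * D * (1 / (real (Suc j) * (1 + \<bar>real j - real N\<bar>)))" by simp
    also have "\<dots> \<le> C * D * (\<epsilon> N * (real (Suc j) powr (- 3 / 2) + (1 + \<bar>real j - real N\<bar>) powr (- 3 / 2)))"
      unfolding \<epsilon>_def by (intro mult_left_mono inverse_mult_bound) (use C D in auto)
    also have "(1 + \<bar>real j - real N\<bar>) powr (- 3 / 2) = V N j"
      by (auto simp: V_def W_def of_nat_diff)
    finally show ?thesis by (simp add: W_def mult.assoc)
  qed
  have sWV: "summable (\<lambda>j. C * D * \<epsilon> N * (W j + V N j))" for N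
    by (intro summable_mult summable_add W sV)
  have se: "summable (e N)" for N
    by (rule summable_comparison_test'[OF sWV e])
  have "norm (suminf (e N)) \<le> C * D * \<epsilon> N * (3 * suminf W)" for N
  proof -
    have "norm (suminf (e N)) \<le> (\<Sum>j. C * D * \<epsilon> N * (W j + V N j))"
      by (rule norm_suminf_le[OF e sWV])
    also have "\<dots> = C * D * \<epsilon> N * (suminf W + suminf (V N))"
      using W(1) sV by (simp add: suminf_mult summable_add suminf_add)
    also have "\<dots> \<le> C * D * \<epsilon> N * (3 * suminf W)"
      by (rule mult_left_mono) (use V[of N] C D in \<open>auto simp: \<epsilon>_def\<close>)
    finally show ?thesis .
  qed
  moreover have "(\<lambda>N. C * D * \<epsilon> N * (3 * suminf W)) \<longlonglongrightarrow> C * D * 0 * (3 * suminf W)"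
  proof (intro tendsto_mult tendsto_const)
    have "filterlim (\<lambda>N. real (N + 2) * (1 / 2)) at_top sequentially"
      by (rule filterlim_at_top_mult_tendsto_pos[OF tendsto_const])
        (auto intro: filterlim_tendsto_add_at_top[OF tendsto_const filterlim_real_sequentially])
    then show "\<epsilon> \<longlonglongrightarrow> 0" unfolding \<epsilon>_def by (intro tendsto_neg_powr) simp_all
  qed
  ultimately have e0: "(\<lambda>N. suminf (e N)) \<longlonglongrightarrow> 0"
    by (intro Lim_null_comparison[of "\<lambda>N. suminf (e N)"]) auto
  \<comment> \<open>The main part has finitely many nonzero terms for each \<open>N\<close>.\<close>
  have hG: "(\<lambda>j. h j * (if j < N then G else 0)) sums ((\<Sum>j<N. h j) * G)" for N
    using sums_finite[of "{..<N}" "\<lambda>j. h j * (if j < N then G else 0)"] by (simp add: sum_distrib_right)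
  have s: "(\<lambda>j. h j * g N j) sums (suminf (e N) + (\<Sum>j<N. h j) * G)" for N
    using sums_add[OF summable_sums[OF se[of N]] hG[of N]]
    by (simp only: e_def right_diff_distrib diff_add_cancel)
  show "summable (\<lambda>j. h j * g N j)" using s by (rule sums_summable)
  have "(\<lambda>N. suminf (e N) + (\<Sum>j<N. h j) * G) \<longlonglongrightarrow> 0 + L * G"
    using h(1) e0 unfolding sums_def by (intro tendsto_intros)
  then show "(\<lambda>N. \<Sum>j. h j * g N j) \<longlonglongrightarrow> L * G" by (simp add: sums_unique[OF s, symmetric])
qed

section \<open>Polylogarithms and \<open>S_tilde\<close> as limits of symmetric sums without n =
  0\<close>

lemma polylog_sums:
  fixes b w :: complex
  assumes b: "\<And>k::nat. of_nat k + b \<noteq> 0" and w: "norm w = 1" and p: "p \<ge> 1" "(p, w) \<noteq> (1, 1)"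
  shows "(\<lambda>j. w ^ j / (of_nat j + b) ^ p) sums (inverse w * Li_shift p w b)"
proof -
  note s = polylog_tail(1)[OF b w p]
  have "Li_shift p w b = w * (\<Sum>j. w ^ j / (of_nat j + b) ^ p)"
    using suminf_mult[OF s, of w] by (simp add: Li_shift_def)
  moreover have "w \<noteq> 0" using w by auto
  ultimately show ?thesis using summable_sums[OF s] by (simp add: mult.assoc[symmetric])
qed

lemma Li_sums:
  fixes w :: complex
  assumes w: "norm w = 1" and p: "p \<ge> 1" "(p, w) \<noteq> (1, 1)"
  shows "(\<lambda>k. w ^ Suc k / of_nat (Suc k) ^ p) sums Li p w"
proof -
  have "of_nat k + 1 \<noteq> (0 :: complex)" for k :: nat
    using of_nat_neq_0[of k, where 'a = complex] by (simp add: add.commute)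
  from summable_mult[OF polylog_tail(1)[OF this w p], of w] show ?thesis
    by (simp add: Li_def summable_sums add.commute)
qed

text \<open>Split \<open>c k\<close> into its limit \<open>A\<close> and a remainder: the first
  gives a convergent polylogarithm, the second terms of size O(1/k^2).\<close>

lemma summable_polylog_weighted:
  fixes w A :: complex
  assumes w: "norm w = 1" and p: "p \<ge> 1" "(p, w) \<noteq> (1, 1)"
    and c: "\<And>k. norm (c k - A) \<le> C / real (Suc k)"
  shows "summable (\<lambda>k. w ^ Suc k / of_nat (Suc k) ^ p * c k)"
proof -
  have "norm (w ^ Suc k / of_nat (Suc k) ^ p * (c k - A)) \<le> C / real (Suc k) ^ 2" for k
  proof -
    have "norm (w ^ Suc k / of_nat (Suc k) ^ p) = 1 / real (Suc k) ^ p"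
      by (simp only: norm_divide norm_power w norm_of_nat power_one)
    also have "\<dots> \<le> 1 / real (Suc k)"
      using power_increasing[OF p(1), of "real (Suc k)"] by (intro divide_left_mono) auto
    finally have "norm (w ^ Suc k / of_nat (Suc k) ^ p) * norm (c k - A)
        \<le> 1 / real (Suc k) * (C / real (Suc k))"
      by (intro mult_mono c) auto
    then show ?thesis by (simp only: norm_mult power2_eq_square times_divide_times_eq mult_1)
  qed
  note 1 = sum_inverse_squares_tail(1)[OF this]
  note 2 = summable_mult2[OF sums_summable[OF Li_sums[OF w p]], of A]
  show ?thesis
    using summable_add[OF 1 2] by (simp only: right_diff_distrib diff_add_cancel)
qed

lemma sum_punctured:
  fixes f :: "int \<Rightarrow> 'a :: comm_monoid_add"
  shows "(\<Sum>n\<in>{- int N..int N} - {0}. f n) = (\<Sum>k<N. f (int (Suc k)) + f (- int (Suc k)))"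
proof (induction N)
  case (Suc N)
  have "{- int (Suc N)..int (Suc N)} - {0} =
      insert (int (Suc N)) (insert (- int (Suc N)) ({- int N..int N} - {0}))" by auto
  then show ?case using Suc by (simp add: add_ac)
qed auto

lemma tendsto_sum_punctured:
  fixes f :: "int \<Rightarrow> 'a :: real_normed_vector"
  assumes "(\<lambda>k. f (int (Suc k))) sums A" "(\<lambda>k. f (- int (Suc k))) sums B"
  shows "(\<lambda>N. \<Sum>n\<in>{- int N..int N} - {0}. f n) \<longlonglongrightarrow> A + B"
  unfolding sum_punctured using sums_add[OF assms] by (simp add: sums_def)

text \<open>Positive n give the polylogarithm at \<open>inverse w\<close>, negative n the one at
  \<open>w\<close> with the sign of (-n)^(-p).\<close>

lemma tendsto_Li_bilateral:
  fixes w :: complex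
  assumes w: "norm w = 1" and p: "p \<ge> 1" "(p, w) \<noteq> (1, 1)"
  shows "(\<lambda>N. \<Sum>n\<in>{- int N..int N} - {0}. w powi (- n) * (1 / of_int n) ^ p)
    \<longlonglongrightarrow> Li p (inverse w) + (- 1) ^ p * Li p w"
proof (rule tendsto_sum_punctured)
  have w': "norm (inverse w) = 1" "(p, inverse w) \<noteq> (1, 1)" using w p by (auto simp: norm_inverse)
  have "w powi (- int (Suc k)) * (1 / of_int (int (Suc k))) ^ p = inverse w ^ Suc k / of_nat (Suc k) ^ p" for k
    by (simp only: power_int_minus power_int_of_nat of_int_of_nat_eq power_divide power_one
        power_inverse times_divide_eq_right mult_1_right)
  then show "(\<lambda>k. w powi (- int (Suc k)) * (1 / of_int (int (Suc k))) ^ p) sums Li p (inverse w)"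
    using Li_sums[OF w'(1) p(1) w'(2)] by (simp only:)
  have "w powi (- (- int (Suc k))) * (1 / of_int (- int (Suc k))) ^ p = (- 1) ^ p * (w ^ Suc k / of_nat (Suc k) ^ p)" for k
  proof -
    have "1 / (of_int (- int (Suc k)) :: complex) = - 1 * (1 / of_nat (Suc k))"
      by (simp only: of_int_minus of_int_of_nat_eq minus_divide_right[symmetric] mult_minus_left mult_1_left)
    then show ?thesis
      by (simp only: power_mult_distrib minus_minus power_int_of_nat power_divide power_one
          times_divide_eq_right mult_1_right mult.commute[of "w ^ Suc k"])
  qed
  then show "(\<lambda>k. w powi (- (- int (Suc k))) * (1 / of_int (- int (Suc k))) ^ p) sums ((- 1) ^ p * Li p w)"
    using sums_mult[OF Li_sums[OF w p]] by (simp only:)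
qed

lemma root_of_unity_norm: "root_of_unity z \<Longrightarrow> norm z = 1"
proof -
  assume "root_of_unity z"
  then obtain n where n: "n > 0" "z ^ n = 1" by (auto simp: root_of_unity_def)
  from n(2) have "norm z ^ n = 1 ^ n" by (metis norm_power norm_one power_one)
  with n(1) show ?thesis using power_eq_imp_eq_base[of "norm z" n 1] by auto
qed

text \<open>This puts the left-hand side of the theorem into bilateral form. Positive n give the
  first series; for negative n the sign (-1)^q of n^(-q) meets the sign -(-1)^p of the
  antiderivative.\<close>

lemma tendsto_S_tilde_bilateral:
  fixes y z a :: complex
  assumes a: "a \<notin> \<int>" and y: "norm y = 1" and z: "norm z = 1"
    and p: "p \<ge> 1" "(p, y) \<noteq> (1, 1)" and q: "q \<ge> 1" "(q, z) \<noteq> (1, 1)"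
  defines "f \<equiv> \<lambda>k::int. y powi k / (of_int k + a) ^ p"
  shows "(\<lambda>N. \<Sum>n\<in>{- int N..int N} - {0}. z powi (- n) * (1 / of_int n) ^ q * prim f n) \<longlonglongrightarrow>
    inverse y * S_tilde (a - 1) p q y (inverse z) - (- 1) ^ (p + q) * S_tilde (- a) p q (inverse y) z"
proof -
  have y0: "y \<noteq> 0" using y by auto
  have z': "norm (inverse z) = 1" "(q, inverse z) \<noteq> (1, 1)" using z q by (auto simp: norm_inverse)
  \<comment> \<open>The antiderivative approaches its limits at rate 1/|m|, which makes both series
    summable even for \<open>q = 1\<close>.\<close>
  obtain L M C where *: "\<And>m. norm (prim f m - (if m \<ge> 0 then L else M)) \<le> C / (1 + \<bar>real_of_int m\<bar>)"
    using prim_polylog(2)[OF a y p, folded f_def] by blast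
  have C: "C \<ge> 0" using order_trans[OF norm_ge_zero *[of 0]] by simp
  have mono: "C / (1 + real (Suc k)) \<le> C / real (Suc k)" for k
    using C by (intro divide_left_mono) auto
  have "norm (prim f (int (Suc k)) - L) \<le> C / real (Suc k)" for k
    using order_trans[OF *[of "int (Suc k)"]] mono[of k] by simp
  note s1 = summable_polylog_weighted[OF z'(1) q(1) z'(2) this]
  have "norm (prim f (- int (Suc k)) - M) \<le> C / real (Suc k)" for k
    using order_trans[OF *[of "- int (Suc k)"]] mono[of k] by simp
  note s2 = summable_polylog_weighted[OF z q this]
  \<comment> \<open>\<open>zeta_partial\<close> starts at 1 and \<open>prim\<close> at 0: the
    parameter a - 1 absorbs the shift in the denominator, the factor \<open>y\<close> that in the
    power.\<close>
  have z1: "zeta_partial n p y (a - 1) = y * prim f (int n)" for n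
  proof -
    have "zeta_partial n p y (a - 1) = (\<Sum>k<n. y ^ Suc k / (of_nat (Suc k) + (a - 1)) ^ p)"
      unfolding zeta_partial_def
      by (rule sum.reindex_bij_witness[of _ Suc "\<lambda>k. k - 1"]) auto
    then show ?thesis by (simp add: prim_of_nat f_def sum_distrib_left)
  qed
  have z2: "prim f (- int n) = - ((- 1) ^ p) * zeta_partial n p (inverse y) (- a)" for n
  proof -
    have "zeta_partial n p (inverse y) (- a) = (\<Sum>k<n. inverse y ^ Suc k / (of_nat (Suc k) + - a) ^ p)"
      unfolding zeta_partial_def
      by (rule sum.reindex_bij_witness[of _ Suc "\<lambda>k. k - 1"]) auto
    moreover have "f (- 1 - int k) = (- 1) ^ p * (inverse y ^ Suc k / (of_nat (Suc k) + - a) ^ p)" for k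
    proof -
      have "- 1 - int k = - int (Suc k)" by simp
      then have "y powi (- 1 - int k) = inverse y ^ Suc k"
        by (simp only: power_int_minus power_int_of_nat power_inverse)
      moreover have "of_int (- 1 - int k) + a = - 1 * (of_nat (Suc k) + - a)" by simp
      moreover have "r / ((- 1) ^ p * s) = (- 1) ^ p * (r / s)" for r s :: complex
        by (cases "even p") auto
      ultimately show ?thesis unfolding f_def by (simp only: power_mult_distrib)
    qed
    ultimately show ?thesis
      unfolding prim_minus_of_nat by (simp only: sum_distrib_left minus_mult_left[symmetric] sum_negf)
  qed
  have "(\<lambda>N. \<Sum>n\<in>{- int N..int N} - {0}. z powi (- n) * (1 / of_int n) ^ q * prim f n) \<longlonglongrightarrow>
    inverse y * S_tilde (a - 1) p q y (inverse z) + (- ((- 1) ^ (p + q)) * S_tilde (- a) p q (inverse y) z)"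
  proof (rule tendsto_sum_punctured)
    have 1: "z powi (- int (Suc k)) * (1 / of_int (int (Suc k))) ^ q * prim f (int (Suc k))
        = inverse z ^ Suc k / of_nat (Suc k) ^ q * prim f (int (Suc k))" for k
      by (simp only: power_int_minus power_int_of_nat of_int_of_nat_eq power_divide power_one
          power_inverse times_divide_eq_right mult_1_right)
    have 2: "zeta_partial (Suc k) p y (a - 1) / of_nat (Suc k) ^ q * inverse z ^ Suc k
        = y * (inverse z ^ Suc k / of_nat (Suc k) ^ q * prim f (int (Suc k)))" for k
      unfolding z1 by (simp only: times_divide_eq_right times_divide_eq_left mult_ac)
    have "inverse y * S_tilde (a - 1) p q y (inverse z)
        = (\<Sum>k. inverse z ^ Suc k / of_nat (Suc k) ^ q * prim f (int (Suc k)))"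
      unfolding S_tilde_def 2 suminf_mult[OF s1] by (simp only: mult.assoc[symmetric] left_inverse[OF y0] mult_1_left)
    with summable_sums[OF s1]
    show "(\<lambda>k. z powi (- int (Suc k)) * (1 / of_int (int (Suc k))) ^ q * prim f (int (Suc k)))
        sums (inverse y * S_tilde (a - 1) p q y (inverse z))"
      by (simp only: 1)
    have 3: "z powi (- (- int (Suc k))) * (1 / of_int (- int (Suc k))) ^ q * prim f (- int (Suc k))
        = (- 1) ^ q * (z ^ Suc k / of_nat (Suc k) ^ q * prim f (- int (Suc k)))" for k
    proof -
      have "1 / (of_int (- int (Suc k)) :: complex) = - 1 * (1 / of_nat (Suc k))"
        by (simp only: of_int_minus of_int_of_nat_eq minus_divide_right[symmetric] mult_minus_left mult_1_left)
      then have "(1 / (of_int (- int (Suc k)) :: complex)) ^ q = (- 1) ^ q * (1 / of_nat (Suc k) ^ q)"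
        by (simp only: power_mult_distrib power_divide power_one)
      then show ?thesis
        by (simp only: minus_minus power_int_of_nat times_divide_eq_right times_divide_eq_left mult_1_left mult_1_right mult_ac)
    qed
    have 4: "zeta_partial (Suc k) p (inverse y) (- a) / of_nat (Suc k) ^ q * z ^ Suc k
        = - ((- 1) ^ p) * (z ^ Suc k / of_nat (Suc k) ^ q * prim f (- int (Suc k)))" for k
    proof -
      \<comment> \<open>Applied with s = (-1)^p, which is its own inverse.\<close>
      have "c / K * r = - s * (r / K * (- s * c))" if "s * s = 1" for r s c K :: complex
      proof -
        have "- s * (r / K * (- s * c)) = s * s * (r / K * c)"
          by (simp only: mult_minus_left mult_minus_right minus_minus mult_ac)
        then show ?thesis using that by simp
      qed
      moreover have "(- 1) ^ p * (- 1) ^ p = (1 :: complex)" by (cases "even p") auto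
      ultimately show ?thesis unfolding z2 by blast
    qed
    have "- ((- 1) ^ (p + q)) * S_tilde (- a) p q (inverse y) z
        = (- 1) ^ q * (\<Sum>k. z ^ Suc k / of_nat (Suc k) ^ q * prim f (- int (Suc k)))"
      unfolding S_tilde_def 4 suminf_mult[OF s2] by (cases "even p"; simp add: power_add)
    with sums_mult[OF summable_sums[OF s2], of "(- 1) ^ q"]
    show "(\<lambda>k. z powi (- (- int (Suc k))) * (1 / of_int (- int (Suc k))) ^ q * prim f (- int (Suc k)))
        sums (- ((- 1) ^ (p + q)) * S_tilde (- a) p q (inverse y) z)"
      by (simp only: 3)
  qed
  then show ?thesis by simp
qed

section \<open>Window sums and their limit against polylogarithm weights\<close>

lemma sum_window:
  fixes x a :: complex and N i j :: nat
  assumes x: "x \<noteq> 0"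
  defines "f \<equiv> \<lambda>k::int. inverse x powi k / (of_int k + a) ^ i"
  shows "(\<Sum>n\<in>{- int N..int N} - {0}. x powi (- n) * (1 / (of_int n + of_nat j + a)) ^ i)
    = x ^ j * (prim f (int j + int N + 1) - prim f (int j - int N)) - (1 / (of_nat j + a)) ^ i"
proof -
  have eq: "x powi (- n) * (1 / (of_int n + of_nat j + a)) ^ i = x ^ j * f (int j + n)" for n
    using x by (simp add: f_def power_int_add power_int_minus power_divide add_ac
        field_simps power_int_inverse power_inverse)
  \<comment> \<open>Substituting k = j + n moves the symmetric range to the window of radius
    \<open>N\<close> around \<open>j\<close>.\<close>
  have "(\<Sum>n\<in>{- int N..int N}. f (int j + n)) = (\<Sum>k\<in>{int j - int N..int j - int N + int (2 * N)}. f k)"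
    by (rule sum.reindex_bij_witness[of _ "\<lambda>k. k - int j" "\<lambda>n. int j + n"]) auto
  also have "\<dots> = prim f (int j + int N + 1) - prim f (int j - int N)"
    unfolding sum_eq_prim_diff by (simp add: algebra_simps)
  finally have "(\<Sum>n\<in>{- int N..int N}. x powi (- n) * (1 / (of_int n + of_nat j + a)) ^ i)
      = x ^ j * (prim f (int j + int N + 1) - prim f (int j - int N))"
    by (simp only: eq sum_distrib_left[symmetric])
  \<comment> \<open>Splitting off n = 0 yields the correction from which the binomial term of the
    theorem arises.\<close>
  moreover have "(\<Sum>n\<in>{- int N..int N}. x powi (- n) * (1 / (of_int n + of_nat j + a)) ^ i)
      = (1 / (of_nat j + a)) ^ i +
        (\<Sum>n\<in>{- int N..int N} - {0}. x powi (- n) * (1 / (of_int n + of_nat j + a)) ^ i)"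
    by (subst sum.remove[of _ 0]) auto
  ultimately show ?thesis by (simp add: algebra_simps)
qed

text \<open>The upper end j + N + 1 of the window always lies near plus infinity. The lower end j -
  N is negative exactly for j < N, so \<open>g N j\<close> is close to \<open>L - M\<close> there
  and close to 0 otherwise, as \<open>sum_concentrated_kernel\<close> requires.\<close>

lemma sum_polylog_window:
  fixes x z a :: complex
  assumes a: "a \<notin> \<int>" and x: "norm x = 1" "x \<noteq> 1" and z: "norm z = 1"
    and i: "i \<ge> 1" and r: "r \<ge> 1" "(r, z) \<noteq> (1, 1)"
  defines "f \<equiv> \<lambda>k::int. inverse x powi k / (of_int k + a) ^ i"
  defines "g \<equiv> \<lambda>N j. prim f (int j + int N + 1) - prim f (int j - int N)"
  defines "h \<equiv> \<lambda>j::nat. z ^ j * (1 / (of_nat j + a)) ^ r"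
  shows "summable (\<lambda>j. h j * g N j)"
    and "(\<lambda>N. \<Sum>j. h j * g N j) \<longlonglongrightarrow> inverse z * Li_shift r z a *
      (x * Li_shift i (inverse x) a + (- 1) ^ i * Li_shift i x (1 - a))"
proof -
  define L M where "L = x * Li_shift i (inverse x) a" and "M = - ((- 1) ^ i) * Li_shift i x (1 - a)"
  have x': "norm (inverse x) = 1" "(i, inverse x) \<noteq> (1, 1)" using x by (auto simp: norm_inverse)
  obtain C where C: "\<And>m. norm (prim f m - (if m \<ge> 0 then L else M)) \<le> C / (1 + \<bar>real_of_int m\<bar>)"
    using prim_polylog(2)[OF a x'(1) i x'(2), folded f_def] unfolding L_def M_def inverse_inverse_eq by blast
  have C0: "C \<ge> 0" using order_trans[OF norm_ge_zero C[of 0]] by simp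
  have nz: "of_nat k + a \<noteq> 0" for k :: nat
    using a by (metis Ints_minus Ints_of_nat add.commute eq_neg_iff_add_eq_0)
  obtain K where K: "K > 0" "\<And>k. norm (1 / (of_nat k + a)) \<le> K / real (Suc k)"
    using inverse_shift_bound[OF nz] by blast
  have h: "h sums (inverse z * Li_shift r z a)"
    using polylog_sums[OF nz z r] by (simp add: h_def power_divide)
  have hb: "norm (h j) \<le> K ^ r / real (Suc j)" for j
  proof -
    have "norm (h j) = norm (1 / (of_nat j + a)) ^ r" by (simp add: h_def norm_mult norm_power z)
    also have "\<dots> \<le> (K / real (Suc j)) ^ r" by (intro power_mono K) auto
    also have "\<dots> \<le> K ^ r / real (Suc j)"
      unfolding power_divide using power_increasing[OF r(1), of "real (Suc j)"] K
      by (intro divide_left_mono) auto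
    finally show ?thesis .
  qed
  have gb: "norm (g N j - (if j < N then L - M else 0)) \<le> 2 * C / (1 + \<bar>real j - real N\<bar>)" for N j
  proof -
    define m where "m = int j - int N"
    \<comment> \<open>Since j + N + 1 \<ge> |j - N|, the error at the upper end fits the bound
      dictated by the lower end.\<close>
    have 1: "norm (prim f (int j + int N + 1) - L) \<le> C / (1 + \<bar>real j - real N\<bar>)"
    proof -
      have "norm (prim f (int j + int N + 1) - L) \<le> C / (1 + \<bar>real_of_int (int j + int N + 1)\<bar>)"
        using C[of "int j + int N + 1"] by simp
      also have "\<dots> \<le> C / (1 + \<bar>real j - real N\<bar>)"
        by (rule divide_left_mono) (use C0 in auto)
      finally show ?thesis .
    qed
    have 2: "norm (prim f m - (if m \<ge> 0 then L else M)) \<le> C / (1 + \<bar>real j - real N\<bar>)"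
      using C[of m] by (simp add: m_def)
    have "(if j < N then L - M else 0) = L - (if m \<ge> 0 then L else M)" by (auto simp: m_def)
    then have "g N j - (if j < N then L - M else 0) =
        (prim f (int j + int N + 1) - L) - (prim f m - (if m \<ge> 0 then L else M))"
      by (simp only: g_def m_def) simp
    also have "norm \<dots> \<le> C / (1 + \<bar>real j - real N\<bar>) + C / (1 + \<bar>real j - real N\<bar>)"
      by (rule order_trans[OF norm_triangle_ineq4 add_mono[OF 1 2]])
    finally show ?thesis by simp
  qed
  note * = sum_concentrated_kernel[OF h hb gb]
  show "summable (\<lambda>j. h j * g N j)" by (rule *)
  show "(\<lambda>N. \<Sum>j. h j * g N j) \<longlonglongrightarrow> inverse z * Li_shift r z a *
      (x * Li_shift i (inverse x) a + (- 1) ^ i * Li_shift i x (1 - a))"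
    using *(2) by (simp add: L_def M_def)
qed

subsection \<open>The double sum\<close>

text \<open>Partial fractions with 1/n, 1/(n+j+a) and \<open>t\<close>. Powers of 1/n leave a sum
  free of \<open>j\<close>; powers of 1/(n+j+a) leave window sums, whose n = 0 correction is
  subtracted.\<close>

lemma sum_partial_fractions_window:
  fixes x y a :: complex and N P Q j :: nat
  assumes a: "a \<notin> \<int>" and xy: "x \<noteq> 0" "y \<noteq> 0"
  defines "t \<equiv> 1 / (of_nat j + a)"
  defines "gx \<equiv> \<lambda>i k::int. inverse x powi k / (of_int k + a) ^ i"
  defines "g \<equiv> \<lambda>i. prim (gx i) (int j + int N + 1) - prim (gx i) (int j - int N)"
  shows "(\<Sum>n\<in>{- int N..int N} - {0}. (x * y) powi (- n) * (1 / of_int n) ^ Suc Q *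
        (y powi (n + int j) / (of_int (n + int j) + a) ^ Suc P)) =
      (\<Sum>k\<le>Q. of_nat ((P + k) choose k) * (- 1) ^ k * (y ^ j * t ^ (Suc P + k)) *
        (\<Sum>n\<in>{- int N..int N} - {0}. x powi (- n) * (1 / of_int n) ^ (Suc Q - k))) +
      (\<Sum>k\<le>P. of_nat ((Q + k) choose k) * (- 1) ^ Suc Q *
        ((x * y) ^ j * t ^ (Suc Q + k) * g (Suc P - k) - y ^ j * t ^ (Suc P + Suc Q)))"
    (is "(\<Sum>n\<in>?I. ?s n) = (\<Sum>k\<le>Q. ?c k * _ * _) + (\<Sum>k\<le>P. ?d k * _)")
proof -
  have nz: "of_int k + a \<noteq> 0" for k
    using a by (metis Ints_minus Ints_of_int add.commute eq_neg_iff_add_eq_0)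
  have t0: "of_nat j + a \<noteq> 0" using nz[of "int j"] by simp
  define v where "v n = 1 / (of_int n + of_nat j + a)" for n :: int
  have summand: "?s n =
      (\<Sum>k\<le>Q. ?c k * (y ^ j * t ^ (Suc P + k)) * (x powi (- n) * (1 / of_int n) ^ (Suc Q - k))) +
      (\<Sum>k\<le>P. ?d k * (y ^ j * t ^ (Suc Q + k)) * (x powi (- n) * v n ^ (Suc P - k)))"
    if "n \<in> ?I" for n
  proof -
    define u :: complex where "u = 1 / of_int n"
    have n0: "of_int n \<noteq> (0 :: complex)" using that by simp
    have nj: "of_int n + of_nat j + a \<noteq> 0" using nz[of "n + int j"] by (simp add: add_ac)
    have "u * v n = t * (u - v n)"
      unfolding u_def v_def t_def using n0 nj t0 by (simp add: divide_simps)
    note pf = partial_fractions_Suc[OF this, of Q P]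
    \<comment> \<open>The phases in \<open>y\<close> cancel up to y^j, so the dependence on n is
      through \<open>x\<close> alone.\<close>
    have "(x * y) powi (- n) * y powi (n + int j) = x powi (- n) * y ^ j"
      using xy by (simp add: power_int_mult_distrib power_int_add power_int_minus)
    moreover have "of_int (n + int j) + a = of_int n + of_nat j + a" by simp
    ultimately have "?s n = x powi (- n) * y ^ j * (u ^ Suc Q * v n ^ Suc P)"
      unfolding u_def v_def power_divide power_one by (simp add: field_simps)
    also have "\<dots> = (\<Sum>k\<le>Q. ?c k * (y ^ j * t ^ (Suc P + k)) * (x powi (- n) * u ^ (Suc Q - k))) +
        (\<Sum>k\<le>P. ?d k * (y ^ j * t ^ (Suc Q + k)) * (x powi (- n) * v n ^ (Suc P - k)))"
      unfolding pf distrib_left sum_distrib_left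
    proof (intro arg_cong2[of _ _ _ _ "(+)"] sum.cong refl)
      fix k
      have "(- t) ^ k = (- 1) ^ k * t ^ k" "(- t) ^ Suc Q = (- 1) ^ Suc Q * t ^ Suc Q"
        by (rule power_minus)+
      then show "x powi (- n) * y ^ j * (of_nat (P + k choose k) * (- t) ^ k * t ^ Suc P * u ^ (Suc Q - k))
          = ?c k * (y ^ j * t ^ (Suc P + k)) * (x powi (- n) * u ^ (Suc Q - k))"
        and "x powi (- n) * y ^ j * (of_nat (Q + k choose k) * t ^ k * (- t) ^ Suc Q * v n ^ (Suc P - k))
          = ?d k * (y ^ j * t ^ (Suc Q + k)) * (x powi (- n) * v n ^ (Suc P - k))"
        by (simp_all only: power_add mult_ac)
    qed
    finally show ?thesis unfolding u_def .
  qed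
  have win: "(\<Sum>n\<in>?I. x powi (- n) * v n ^ i) = x ^ j * g i - t ^ i" for i
    unfolding v_def g_def gx_def t_def by (rule sum_window[OF xy(1)])
  have split: "(\<Sum>n\<in>?I. ?s n) =
      (\<Sum>k\<le>Q. ?c k * (y ^ j * t ^ (Suc P + k)) *
        (\<Sum>n\<in>?I. x powi (- n) * (1 / of_int n) ^ (Suc Q - k))) +
      (\<Sum>k\<le>P. ?d k * (y ^ j * t ^ (Suc Q + k)) * (x ^ j * g (Suc P - k) - t ^ (Suc P - k)))"
    unfolding win[symmetric] sum_distrib_left
    by (simp only: summand sum.distrib sum.swap[of _ _ ?I] cong: sum.cong)
  \<comment> \<open>The powers of \<open>t\<close> in the n = 0 correction multiply to the same
    exponent for every \<open>k\<close>, so only the binomial coefficients remain to be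
    summed.\<close>
  have "?d k * (y ^ j * t ^ (Suc Q + k)) * (x ^ j * g (Suc P - k) - t ^ (Suc P - k))
      = ?d k * ((x * y) ^ j * t ^ (Suc Q + k) * g (Suc P - k) - y ^ j * t ^ (Suc P + Suc Q))"
    if "k \<in> {..P}" for k
  proof -
    have "Suc P + Suc Q = Suc Q + k + (Suc P - k)" using that by simp
    then have "t ^ (Suc P + Suc Q) = t ^ (Suc Q + k) * t ^ (Suc P - k)" by (simp only: power_add)
    then show ?thesis by (simp only: power_mult_distrib right_diff_distrib mult_ac)
  qed
  then show ?thesis unfolding split by (intro arg_cong2[of _ _ _ _ "(+)"] sum.cong refl)
qed

text \<open>For fixed \<open>N\<close> the sum over n is finite, so exchanging it with the series
  over j needs only linearity. What remains is a finite combination of sequences in \<open>N\<close>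
  with known limits.\<close>

lemma tendsto_double_sum:
  fixes x y a :: complex and P Q :: nat
  assumes a: "a \<notin> \<int>" and x: "norm x = 1" "x \<noteq> 1" and y: "norm y = 1"
    and py: "(Suc P, y) \<noteq> (1, 1)" and qz: "(Suc Q, x * y) \<noteq> (1, 1)"
  defines "z \<equiv> x * y"
  defines "f \<equiv> \<lambda>k::int. y powi k / (of_int k + a) ^ Suc P"
  defines "G \<equiv> \<lambda>i. x * Li_shift i (inverse x) a + (- 1) ^ i * Li_shift i x (1 - a)"
  shows "(\<lambda>N. \<Sum>n\<in>{- int N..int N} - {0}.
      z powi (- n) * (1 / of_int n) ^ Suc Q * (inverse y * Li_shift (Suc P) y a - prim f n)) \<longlonglongrightarrow>
    (\<Sum>k\<le>Q. of_nat ((P + k) choose k) * (- 1) ^ k * (inverse y * Li_shift (Suc P + k) y a) *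
      (Li (Suc Q - k) (inverse x) + (- 1) ^ (Suc Q - k) * Li (Suc Q - k) x)) +
    (\<Sum>k\<le>P. of_nat ((Q + k) choose k) * (- 1) ^ Suc Q *
      (inverse z * Li_shift (Suc Q + k) z a * G (Suc P - k) - inverse y * Li_shift (Suc P + Suc Q) y a))"
proof -
  have z: "norm z = 1" using x y by (simp add: z_def norm_mult)
  have xy0: "x \<noteq> 0" "y \<noteq> 0" using x y by auto
  have nza: "of_nat k + a \<noteq> 0" for k :: nat
    using a by (metis Ints_minus Ints_of_nat add.commute eq_neg_iff_add_eq_0)

  define A where "A = inverse y * Li_shift (Suc P) y a"
  define t where "t = (\<lambda>j::nat. 1 / (of_nat j + a))"
  define I where "I = (\<lambda>N::nat. {- int N..int N} - {0})"
  define \<kappa> where "\<kappa> = (\<lambda>n::int. z powi (- n) * (1 / of_int n) ^ Suc Q)"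
  define X where "X = (\<lambda>N i. \<Sum>n\<in>I N. x powi (- n) * (1 / of_int n) ^ i)"
  define Y where "Y r = inverse y * Li_shift r y a" for r
  define gx where "gx = (\<lambda>i (k::int). inverse x powi k / (of_int k + a) ^ i)"
  define g where "g = (\<lambda>i N j. prim (gx i) (int j + int N + 1) - prim (gx i) (int j - int N))"
  define H where "H k N = (\<Sum>j. z ^ j * t j ^ (Suc Q + k) * g (Suc P - k) N j)" for k N
  define c d :: "nat \<Rightarrow> complex"
    where "c = (\<lambda>k. of_nat ((P + k) choose k) * (- 1) ^ k)"
      and "d = (\<lambda>k. of_nat ((Q + k) choose k) * (- 1) ^ Suc Q)"

  have Ysums: "(\<lambda>j. y ^ j * t j ^ r) sums Y r" if "r \<ge> Suc P" for r
  proof -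
    have "r \<ge> 1" "(r, y) \<noteq> (1, 1)" using that py by auto
    from polylog_sums[OF nza y this] show ?thesis by (simp add: Y_def t_def power_divide)
  qed
  have H: "summable (\<lambda>j. z ^ j * t j ^ (Suc Q + k) * g (Suc P - k) N j)"
    "H k \<longlonglongrightarrow> inverse z * Li_shift (Suc Q + k) z a * G (Suc P - k)" if "k \<le> P" for k N
  proof -
    \<comment> \<open>Exponent 1 at \<open>z\<close> can occur only for k = 0, where
      \<open>qz\<close> excludes \<open>z = 1\<close>.\<close>
    have "Suc P - k \<ge> 1" "Suc Q + k \<ge> 1" "(Suc Q + k, z) \<noteq> (1, 1)"
      using that qz by (auto simp: z_def)
    note * = sum_polylog_window[OF a x z this]
    show "summable (\<lambda>j. z ^ j * t j ^ (Suc Q + k) * g (Suc P - k) N j)"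
      using *(1) unfolding g_def gx_def t_def .
    show "H k \<longlonglongrightarrow> inverse z * Li_shift (Suc Q + k) z a * G (Suc P - k)"
      using *(2) unfolding g_def gx_def t_def H_def G_def .
  qed

  have inner: "(\<Sum>n\<in>I N. \<kappa> n * f (n + int j)) =
      (\<Sum>k\<le>Q. c k * (y ^ j * t j ^ (Suc P + k)) * X N (Suc Q - k)) +
      (\<Sum>k\<le>P. d k * (z ^ j * t j ^ (Suc Q + k) * g (Suc P - k) N j - y ^ j * t j ^ (Suc P + Suc Q)))" for N j
    unfolding I_def \<kappa>_def f_def c_def d_def X_def g_def gx_def t_def z_def
    by (rule sum_partial_fractions_window[OF a xy0])

  \<comment> \<open>Both sides are the sum of one series over j, evaluated before and after the
    decomposition \<open>inner\<close>.\<close>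
  have swap: "(\<Sum>n\<in>I N. \<kappa> n * (A - prim f n)) =
      (\<Sum>k\<le>Q. c k * Y (Suc P + k) * X N (Suc Q - k)) + (\<Sum>k\<le>P. d k * (H k N - Y (Suc P + Suc Q)))" for N
  proof (rule sums_unique2)
    have "(\<lambda>j. f (int j)) sums A"
      unfolding f_def A_def by (rule prim_polylog(1)[OF a y _ py]) simp
    then show "(\<lambda>j. \<Sum>n\<in>I N. \<kappa> n * f (n + int j)) sums (\<Sum>n\<in>I N. \<kappa> n * (A - prim f n))"
      by (intro sums_sum sums_mult sums_prim)
    have "(\<lambda>j. z ^ j * t j ^ (Suc Q + k) * g (Suc P - k) N j) sums H k N" if "k \<in> {..P}" for k
      unfolding H_def using H(1) that by (intro summable_sums) auto
    then show "(\<lambda>j. \<Sum>n\<in>I N. \<kappa> n * f (n + int j)) sums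
        ((\<Sum>k\<le>Q. c k * Y (Suc P + k) * X N (Suc Q - k)) + (\<Sum>k\<le>P. d k * (H k N - Y (Suc P + Suc Q))))"
      unfolding inner
      by (intro sums_add sums_sum sums_mult sums_mult2 sums_diff Ysums) simp_all
  qed


  have "(\<lambda>N. (\<Sum>k\<le>Q. c k * Y (Suc P + k) * X N (Suc Q - k)) + (\<Sum>k\<le>P. d k * (H k N - Y (Suc P + Suc Q))))
      \<longlonglongrightarrow>
    (\<Sum>k\<le>Q. c k * Y (Suc P + k) * (Li (Suc Q - k) (inverse x) + (- 1) ^ (Suc Q - k) * Li (Suc Q - k) x)) +
    (\<Sum>k\<le>P. d k * (inverse z * Li_shift (Suc Q + k) z a * G (Suc P - k) - Y (Suc P + Suc Q)))"
  proof -
    \<comment> \<open>The exponents descend to 1, where convergence relies on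
      \<open>x \<noteq> 1\<close>.\<close>
    have "(\<lambda>N. X N i) \<longlonglongrightarrow> Li i (inverse x) + (- 1) ^ i * Li i x" if "i \<ge> 1" for i
      unfolding X_def I_def by (rule tendsto_Li_bilateral) (use x that in auto)
    then show ?thesis
      by (intro tendsto_add tendsto_sum tendsto_mult tendsto_diff tendsto_const H(2)) auto
  qed
  then show ?thesis
    unfolding swap[symmetric] unfolding A_def I_def \<kappa>_def Y_def c_def d_def .
qed

section \<open>Binomial reindexing and assembly of the identity\<close>

lemma sum_choose_hockey_stick:
  "(\<Sum>k\<le>P. of_nat ((Q + k) choose k) :: 'a :: semiring_1) = of_nat ((P + Q + 1) choose P)"
  by (simp only: of_nat_sum[symmetric] sum_choose_lower) (simp add: add.commute)

text \<open>The truncated sums weighted by \<open>?A - prim f n\<close> have two limits: the double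
  sum, and by linearity the bilateral polylogarithm times \<open>?A\<close> minus the left-hand
  side. Equating them gives the claim.\<close>

lemma S_tilde_parity:
  fixes x y a :: complex and P Q :: nat
  assumes a: "a \<notin> \<int>" and x: "norm x = 1" "x \<noteq> 1" and y: "norm y = 1"
    and py: "(Suc P, y) \<noteq> (1, 1)" and qz: "(Suc Q, x * y) \<noteq> (1, 1)"
  defines "z \<equiv> x * y"
  defines "G \<equiv> \<lambda>i. x * Li_shift i (inverse x) a + (- 1) ^ i * Li_shift i x (1 - a)"
  shows "inverse y * S_tilde (a - 1) (Suc P) (Suc Q) y (inverse z)
      - (- 1) ^ (Suc P + Suc Q) * S_tilde (- a) (Suc P) (Suc Q) (inverse y) z =
    (Li (Suc Q) (inverse z) + (- 1) ^ Suc Q * Li (Suc Q) z) * (inverse y * Li_shift (Suc P) y a) -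
    ((\<Sum>k\<le>Q. of_nat ((P + k) choose k) * (- 1) ^ k * (inverse y * Li_shift (Suc P + k) y a) *
      (Li (Suc Q - k) (inverse x) + (- 1) ^ (Suc Q - k) * Li (Suc Q - k) x)) +
    (\<Sum>k\<le>P. of_nat ((Q + k) choose k) * (- 1) ^ Suc Q *
      (inverse z * Li_shift (Suc Q + k) z a * G (Suc P - k) - inverse y * Li_shift (Suc P + Suc Q) y a)))"
    (is "?S = ?L * ?A - ?V")
proof -
  define f where "f = (\<lambda>k::int. y powi k / (of_int k + a) ^ Suc P)"
  have z: "norm z = 1" using x y by (simp add: z_def norm_mult)
  have "(\<lambda>N. \<Sum>n\<in>{- int N..int N} - {0}. z powi (- n) * (1 / of_int n) ^ Suc Q * (?A - prim f n)) \<longlonglongrightarrow> ?V"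
    unfolding z_def G_def f_def by (rule tendsto_double_sum[OF a x y py qz])
  moreover have "(\<lambda>N. \<Sum>n\<in>{- int N..int N} - {0}. z powi (- n) * (1 / of_int n) ^ Suc Q * (?A - prim f n))
      \<longlonglongrightarrow> ?L * ?A - ?S"
    unfolding right_diff_distrib sum_subtractf sum_distrib_right[symmetric] f_def
    using a y z py qz[folded z_def]
    by (intro tendsto_diff tendsto_mult tendsto_const tendsto_Li_bilateral tendsto_S_tilde_bilateral) simp_all
  ultimately have "?V = ?L * ?A - ?S" by (rule LIMSEQ_unique)
  then have "?V + ?S = ?L * ?A" by (rule eq_diff_eq[THEN iffD1])
  then show ?thesis by (rule eq_diff_eq[THEN iffD2, OF trans[OF add.commute]])
qed

text \<open>Reversal k = P - m. The sign (-1)^(m+1) on \<open>r\<close> together with the overall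
  minus gives the alternating difference.\<close>

lemma sum_choose_reverse_fst:
  fixes L r s :: "nat \<Rightarrow> 'a :: comm_ring_1"
  shows "(- 1) ^ Suc Q * (\<Sum>m = 0..P. of_nat ((P + Q - m) choose Q) * L (Suc (P + Q) - m) *
      ((- 1) ^ m * r (Suc m) - s (Suc m)))
    = - (\<Sum>k\<le>P. of_nat ((Q + k) choose k) * (- 1) ^ Suc Q *
      (L (Suc Q + k) * (s (Suc P - k) + (- 1) ^ (Suc P - k) * r (Suc P - k))))"
  unfolding sum_distrib_left sum_negf[symmetric]
proof (rule sum.reindex_bij_witness[of _ "\<lambda>k. P - k" "\<lambda>m. P - m"])
  fix m assume "m \<in> {0..P}"
  then have "P + Q - m = Q + (P - m)" "Suc (P + Q) - m = Suc Q + (P - m)" "Suc P - (P - m) = Suc m" by auto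
  moreover have "(Q + (P - m)) choose Q = (Q + (P - m)) choose (P - m)"
    using binomial_symmetric[of Q "Q + (P - m)"] by simp
  ultimately show "- (of_nat ((Q + (P - m)) choose (P - m)) * (- 1) ^ Suc Q *
      (L (Suc Q + (P - m)) * (s (Suc P - (P - m)) + (- 1) ^ (Suc P - (P - m)) * r (Suc P - (P - m))))) =
    (- 1) ^ Suc Q * (of_nat ((P + Q - m) choose Q) * L (Suc (P + Q) - m) *
      ((- 1) ^ m * r (Suc m) - s (Suc m)))"
    by (simp only: power_Suc) (simp add: algebra_simps)
qed auto

text \<open>Reversal k = Q - m. Unlike before, the sign depends on \<open>k\<close>: (-1)^(Q+1) =
  -(-1)^(Q-m) (-1)^m moves the alternation from \<open>s\<close> to \<open>r\<close>.\<close>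

lemma sum_choose_reverse_snd:
  fixes L r s :: "nat \<Rightarrow> 'a :: comm_ring_1"
  shows "(- 1) ^ Suc Q * (\<Sum>m = 0..Q. of_nat ((P + Q - m) choose P) * L (Suc (P + Q) - m) *
      ((- 1) ^ m * r (Suc m) - s (Suc m)))
    = - (\<Sum>k\<le>Q. of_nat ((P + k) choose k) * (- 1) ^ k *
      (L (Suc P + k) * (r (Suc Q - k) + (- 1) ^ (Suc Q - k) * s (Suc Q - k))))"
  unfolding sum_distrib_left sum_negf[symmetric]
proof (rule sum.reindex_bij_witness[of _ "\<lambda>k. Q - k" "\<lambda>m. Q - m"])
  fix m assume m: "m \<in> {0..Q}"
  then have "P + Q - m = P + (Q - m)" "Suc (P + Q) - m = Suc P + (Q - m)" "Suc Q - (Q - m) = Suc m" by auto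
  moreover have "(P + (Q - m)) choose P = (P + (Q - m)) choose (Q - m)"
    using binomial_symmetric[of P "P + (Q - m)"] by simp
  moreover have "(- 1) ^ Suc Q = - ((- 1 :: 'a) ^ (Q - m) * (- 1) ^ m)"
    using m by (simp flip: power_add)
  moreover have "(- 1) ^ m * ((- 1) ^ m * c) = c" for c :: 'a by (cases "even m") auto
  ultimately show "- (of_nat ((P + (Q - m)) choose (Q - m)) * (- 1) ^ (Q - m) *
      (L (Suc P + (Q - m)) * (r (Suc Q - (Q - m)) + (- 1) ^ (Suc Q - (Q - m)) * s (Suc Q - (Q - m))))) =
    (- 1) ^ Suc Q * (of_nat ((P + Q - m) choose P) * L (Suc (P + Q) - m) *
      ((- 1) ^ m * r (Suc m) - s (Suc m)))"
    by (simp only:) (simp add: algebra_simps)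
qed auto

theorem theorem3p3:
  fixes x y a :: complex and p q :: nat
  assumes "root_of_unity x" and "root_of_unity y" and "x \<noteq> 1"
    and "a \<notin> \<int>"
    and "p \<ge> 1" and "q \<ge> 1"
    and "(p, y) \<noteq> (1, 1)" and "(q, x * y) \<noteq> (1, 1)"
  shows
    "inverse y * S_tilde (a - 1) p q y (inverse (x * y))
       - (-1) ^ (p + q) * S_tilde (- a) p q (inverse y) (x * y)
     = inverse y * Li q (inverse (x * y)) * Li_shift p y a
       + (-1) ^ q * inverse y * Li q (x * y) * Li_shift p y a
       + (-1) ^ q * of_nat ((p + q - 1) choose (p - 1)) * inverse y * Li_shift (p + q) y a
       + (-1) ^ q * inverse (x * y) *
           (\<Sum>m = 0..p - 1. of_nat ((p + q - m - 2) choose (q - 1)) * Li_shift (p + q - m - 1) (x * y) a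
              * ((-1) ^ m * Li_shift (m + 1) x (1 - a) - x * Li_shift (m + 1) (inverse x) a))
       + (-1) ^ q * inverse y *
           (\<Sum>m = 0..q - 1. of_nat ((p + q - m - 2) choose (p - 1)) * Li_shift (p + q - m - 1) y a
              * ((-1) ^ m * Li (m + 1) (inverse x) - Li (m + 1) x))"
proof -
  obtain P Q where PQ: "p = Suc P" "q = Suc Q"
    using \<open>p \<ge> 1\<close> \<open>q \<ge> 1\<close> by (metis Suc_le_D One_nat_def)
  define z where "z = x * y"
  have nat: "Suc P + Suc Q - m - 2 = P + Q - m" "Suc P + Suc Q - m - 1 = Suc (P + Q) - m" "m + 1 = Suc m"
    for m by auto
  \<comment> \<open>Collects the n = 0 corrections, which are independent of \<open>k\<close>, into
    the binomial term.\<close>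
  have hockey: "of_nat ((P + Q + 1) choose P) * (- 1) ^ Suc Q * c
      = (\<Sum>k\<le>P. of_nat ((Q + k) choose k) * (- 1) ^ Suc Q * c)" for c :: complex
    by (simp only: sum_distrib_right[symmetric] sum_choose_hockey_stick)
  \<comment> \<open>The prefactor \<open>inverse z\<close> is absorbed into the abstract weight
    \<open>L\<close> of the reversal lemma; \<open>snd\<close> treats \<open>inverse y\<close>
    likewise.\<close>
  have fst: "(- 1) ^ Suc Q * inverse z * (\<Sum>m = 0..P. of_nat ((P + Q - m) choose Q) * Li_shift (Suc (P + Q) - m) z a
        * ((- 1) ^ m * Li_shift (Suc m) x (1 - a) - x * Li_shift (Suc m) (inverse x) a))
      = - (\<Sum>k\<le>P. of_nat ((Q + k) choose k) * (- 1) ^ Suc Q * (inverse z * Li_shift (Suc Q + k) z a *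
        (x * Li_shift (Suc P - k) (inverse x) a + (- 1) ^ (Suc P - k) * Li_shift (Suc P - k) x (1 - a))))"
    using sum_choose_reverse_fst[of Q P "\<lambda>i. inverse z * Li_shift i z a" "\<lambda>i. Li_shift i x (1 - a)"
        "\<lambda>i. x * Li_shift i (inverse x) a"]
    by (simp add: sum_distrib_left mult_ac)
  have snd: "(- 1) ^ Suc Q * inverse y * (\<Sum>m = 0..Q. of_nat ((P + Q - m) choose P) * Li_shift (Suc (P + Q) - m) y a
        * ((- 1) ^ m * Li (Suc m) (inverse x) - Li (Suc m) x))
      = - (\<Sum>k\<le>Q. of_nat ((P + k) choose k) * (- 1) ^ k * (inverse y * Li_shift (Suc P + k) y a) *
        (Li (Suc Q - k) (inverse x) + (- 1) ^ (Suc Q - k) * Li (Suc Q - k) x))"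
    using sum_choose_reverse_snd[of Q P "\<lambda>i. inverse y * Li_shift i y a" "\<lambda>i. Li i (inverse x)"
        "\<lambda>i. Li i x"]
    by (simp add: sum_distrib_left mult_ac)
  have "norm x = 1" "norm y = 1" using assms(1,2) by (auto simp: root_of_unity_norm)
  note parity = S_tilde_parity[OF \<open>a \<notin> \<int>\<close> this(1) \<open>x \<noteq> 1\<close> this(2) assms(7,8)[unfolded PQ], folded z_def]
  show ?thesis
    unfolding z_def[symmetric] PQ parity nat diff_Suc_1 fst snd
    unfolding right_diff_distrib sum_subtractf hockey[symmetric]
    by (simp only: z_def) (simp add: algebra_simps)
qed

end
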